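(* For every closed convex polyhedron $P$ of $\mathbb{R}^3$ with rational vertices (i.e. the convex hull of finitely many points of $\mathbb{Q}^3$), there exists a vector field $b\in C^1_\sharp(Y_3)^3$ whose Herman rotation set $\mathsf{C}_b$ equals $P$.
   Context: $Y_3=\mathbb{R}^3/\mathbb{Z}^3$; $C^1_\sharp(Y_3)$ denotes $\mathbb{Z}^3$-periodic $C^1$ functions on $\mathbb{R}^3$. For $b\in C^1_\sharp(Y_3)^3$ the flow $X$ is $\partial_tX=b(X)$, $X(0,x)=x$. A Borel probability measure $\mu$ on $Y_3$ is invariant if $\int\psi(X(t,y))\,d\mu(y)=\int\psi\,d\mu$ for all $t$ and continuous periodic $\psi$. The Herman rotation set is $\mathsf{C}_b=\{\int_{Y_3}b\,d\mu:\mu\text{ invariant probability measure}\}$. *)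

theory Defs
  imports "HOL-Analysis.Analysis" "HOL-Probability.Probability"
begin

type_synonym vec3 = "real ^ 3"

definition int_vec :: "vec3 \<Rightarrow> bool" where
  "int_vec k \<longleftrightarrow> (\<forall>i. k $ i \<in> \<int>)"

definition rat_vec :: "vec3 \<Rightarrow> bool" where
  "rat_vec v \<longleftrightarrow> (\<forall>i. v $ i \<in> \<rat>)"

definition periodic3 :: "(vec3 \<Rightarrow> 'b) \<Rightarrow> bool" where
  "periodic3 f \<longleftrightarrow> (\<forall>x k. int_vec k \<longrightarrow> f (x + k) = f x)"

definition C1_on_R3 :: "(vec3 \<Rightarrow> vec3) \<Rightarrow> bool" where
  "C1_on_R3 b \<longleftrightarrow> (\<exists>D :: vec3 \<Rightarrow> vec3 \<Rightarrow>\<^sub>L vec3.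
      (\<forall>x. (b has_derivative blinfun_apply (D x)) (at x)) \<and> continuous_on UNIV D)"

definition is_flow :: "(vec3 \<Rightarrow> vec3) \<Rightarrow> (real \<Rightarrow> vec3 \<Rightarrow> vec3) \<Rightarrow> bool" where
  "is_flow b X \<longleftrightarrow> (\<forall>x. X 0 x = x \<and>
      (\<forall>t. ((\<lambda>s. X s x) has_vector_derivative b (X t x)) (at t)))"

text \<open>Fundamental cell [0,1)^3 representing Y_3 = R^3/Z^3.\<close>
definition unit_cell :: "vec3 set" where
  "unit_cell = {y. \<forall>i. 0 \<le> y $ i \<and> y $ i < 1}"

text \<open>Borel probability measures on Y_3, represented as Borel probability
  measures on R^3 concentrated on the fundamental cell.\<close>
definition torus_prob :: "vec3 measure \<Rightarrow> bool" where
  "torus_prob \<mu> \<longleftrightarrow> prob_space \<mu> \<and> sets \<mu> = sets borel \<and> emeasure \<mu> unit_cell = 1"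

definition invariant_measure ::
    "(real \<Rightarrow> vec3 \<Rightarrow> vec3) \<Rightarrow> vec3 measure \<Rightarrow> bool" where
  "invariant_measure X \<mu> \<longleftrightarrow> torus_prob \<mu> \<and>
     (\<forall>\<psi> :: vec3 \<Rightarrow> real. continuous_on UNIV \<psi> \<and> periodic3 \<psi> \<longrightarrow>
        (\<forall>t. (\<integral>y. \<psi> (X t y) \<partial>\<mu>) = (\<integral>y. \<psi> y \<partial>\<mu>)))"

definition rotation_set ::
    "(vec3 \<Rightarrow> vec3) \<Rightarrow> (real \<Rightarrow> vec3 \<Rightarrow> vec3) \<Rightarrow> vec3 set" where
  "rotation_set b X = {(\<integral>y. b y \<partial>\<mu>) | \<mu>. invariant_measure X \<mu>}"

end

theory Submission
  imports Defs
begin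

text \<open>Each vertex \<open>v\<close> is parallel to a nonzero integer vector, so it is the direction of closed
  orbits of the torus, and generic translations make the closed lines chosen for different vertices
  disjoint. Periodic \<open>C\<^sup>1\<close> weights \<open>\<phi> v\<close> that sum to 1, with \<open>\<phi> v = 1\<close> on the lines of \<open>v\<close>, give
  the field \<open>b = (\<Sum>v. \<phi> v *\<^sub>R v)\<close>. Its values lie in the convex hull of the vertices, hence so does
  every mean; conversely \<open>b = v\<close> on the lines of \<open>v\<close>, so these are orbits with mean \<open>v\<close>, and mixtures
  of the uniform measures on them realise the whole convex hull.\<close>

section \<open>Flows of bounded Lipschitz fields\<close>

text \<open>Integrals based at \<open>- real n\<close> and normalised at 0 no longer depend on
  \<open>n\<close> once the interval reaches \<open>t\<close>, so they glue to one antiderivative on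
  the whole line.\<close>

lemma continuous_antiderivative:
  fixes f :: "real \<Rightarrow> 'a::banach"
  assumes "continuous_on UNIV f"
  shows "\<exists>F. F 0 = 0 \<and> (\<forall>t. (F has_vector_derivative f t) (at t))"
proof -
  define F where "F n t = integral {- real n..t} f - integral {- real n..0} f" for n t
  have cont: "continuous_on A f" for A
    using assms continuous_on_subset by blast
  have int: "f integrable_on {a..b}" for a b
    by (rule integrable_continuous_real[OF cont])
  have F_eq: "F m t = F n t" if "m \<le> n" "- real m \<le> t" for m n t
  proof -
    have "integral {- real m..s} f = integral {- real n..s} f - integral {- real n..- real m} f"
      if "- real m \<le> s" for s
      using Henstock_Kurzweil_Integration.integral_combine[of "- real n" "- real m" s f] int that \<open>m \<le> n\<close>
      by (simp add: eq_diff_eq add.commute)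
    then show ?thesis
      using that unfolding F_def by simp
  qed
  have F_deriv: "(F n has_vector_derivative f t) (at t)" if "\<bar>t\<bar> < real n" for n t
  proof -
    have "((\<lambda>t. integral {- real n..t} f) has_vector_derivative f t) (at t within {- real n..real n})"
      using that by (intro integral_has_vector_derivative cont) auto
    then have "((\<lambda>t. integral {- real n..t} f) has_vector_derivative f t) (at t)"
      using that by (subst (asm) at_within_Icc_at) auto
    then show ?thesis
      unfolding F_def by (auto intro!: derivative_eq_intros)
  qed
  \<comment> \<open>The index is the least \<open>n\<close> with
    \<open>\<bar>t\<bar> \<le> n\<close>; by \<open>F_eq\<close> every larger index gives the same
    value.\<close>
  define G where "G t = F (nat \<lceil>\<bar>t\<bar>\<rceil>) t" for t
  have G_eq: "G s = F n s" if "\<bar>s\<bar> < real n" for s n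
    unfolding G_def using that by (intro F_eq) linarith+
  have "(G has_vector_derivative f t) (at t)" for t
  proof -
    obtain n where n: "\<bar>t\<bar> < real n"
      using reals_Archimedean2 by blast
    have "\<forall>\<^sub>F s in nhds t. s \<in> {- real n<..<real n}"
      using n by (intro eventually_nhds_in_open) auto
    then have "\<forall>\<^sub>F s in nhds t. F n s = G s"
      by eventually_elim (auto intro!: G_eq[symmetric])
    then have "\<forall>\<^sub>F s in nhds t. s \<in> UNIV \<longrightarrow> F n s = G s"
      by eventually_elim simp
    from has_vector_derivative_cong_ev[OF this] F_deriv[OF n] G_eq[OF n]
    show ?thesis by simp
  qed
  moreover have "G 0 = 0"
    by (simp add: G_def F_def)
  ultimately show ?thesis by blast
qed

lemma has_vector_derivative_reflect:
  assumes "(F has_vector_derivative d) (at (- s))"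
  shows "((\<lambda>t. F (- t)) has_vector_derivative - d) (at s)"
proof -
  have "(uminus has_vector_derivative (- 1 :: real)) (at s)"
    by (auto intro!: derivative_eq_intros)
  from vector_diff_chain_at[OF this assms] show ?thesis
    by (simp add: o_def)
qed

text \<open>For positive times \<open>C / K * exp (K * t)\<close> is an antiderivative of the bound
  on \<open>f\<close>; negative times follow by reflection. The gain of a factor
  \<open>1 / K\<close> is what makes the Picard operator contract.\<close>

lemma exp_weighted_norm_bound:
  fixes F :: "real \<Rightarrow> 'a::real_normed_vector"
  assumes "K > 0" and "F 0 = 0"
    and F: "\<And>t. (F has_vector_derivative f t) (at t)"
    and f: "\<And>t. norm (f t) \<le> C * exp (K * \<bar>t\<bar>)"
  shows "norm (F t) \<le> C / K * exp (K * \<bar>t\<bar>)"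
proof -
  have "C \<ge> 0"
    using f[of 0] norm_ge_zero[of "f 0"] by (simp del: norm_ge_zero)
  have pos: "norm (G t) \<le> C / K * exp (K * t)"
    if "t \<ge> 0" "G 0 = 0" and G: "\<And>t. (G has_vector_derivative g t) (at t)"
      and g: "\<And>t. norm (g t) \<le> C * exp (K * \<bar>t\<bar>)"
    for G g :: "real \<Rightarrow> 'a" and t
  proof (cases "t = 0")
    case False
    have "norm (G t - G 0) \<le> C / K * exp (K * t) - C / K * exp (K * 0)"
    proof (rule differentiable_bound_general)
      show "continuous_on {0..t} G"
        using G by (meson continuous_at_imp_continuous_on has_vector_derivative_continuous)
      show "continuous_on {0..t} (\<lambda>t. C / K * exp (K * t))"
        by (intro continuous_intros)
      show "((\<lambda>t. C / K * exp (K * t)) has_vector_derivative C * exp (K * s)) (at s)" for s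
        unfolding has_real_derivative_iff_has_vector_derivative[symmetric]
        using \<open>K > 0\<close> by (auto intro!: derivative_eq_intros)
      show "norm (g s) \<le> C * exp (K * s)" if "0 < s" for s
        using g[of s] that by simp
    qed (use False that in auto)
    then show ?thesis
      using divide_nonneg_pos[OF \<open>C \<ge> 0\<close> \<open>K > 0\<close>] \<open>G 0 = 0\<close> by simp
  qed (use that \<open>C \<ge> 0\<close> \<open>K > 0\<close> in simp)
  show ?thesis
  proof (cases "t \<ge> 0")
    case True
    then show ?thesis using pos[of t F f] assms by simp
  next
    case False
    have "((\<lambda>t. F (- t)) has_vector_derivative - f (- s)) (at s)" for s
      by (intro has_vector_derivative_reflect F)
    moreover have "norm (- f (- s)) \<le> C * exp (K * \<bar>s\<bar>)" for s
      using f[of "- s"] by simp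
    ultimately show ?thesis
      using pos[of "-t" "\<lambda>t. F (- t)" "\<lambda>t. - f (- t)"] False assms by simp
  qed
qed

text \<open>The Bielecki weight \<open>exp (- K \<bar>t\<bar>)\<close> makes the Picard operator a contraction
  on the whole time axis at once.\<close>
lemma lipschitz_bounded_global_solution:
  fixes b :: "'a::banach \<Rightarrow> 'a"
  assumes lip: "\<And>x y. norm (b x - b y) \<le> L * norm (x - y)"
    and bdd: "\<And>x. norm (b x) \<le> M"
  shows "\<exists>X. X 0 = x \<and> (\<forall>t. (X has_vector_derivative b (X t)) (at t))"
proof -
  \<comment> \<open>Any \<open>K\<close> above both 0 and \<open>\<bar>L\<bar>\<close> makes the
    contraction factor \<open>\<bar>L\<bar> / K\<close> less than 1.\<close>
  define K where "K = 2 * \<bar>L\<bar> + 1"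
  have K: "K > 0" "\<bar>L\<bar> / K < 1" "\<bar>L\<bar> / K \<ge> 0"
    unfolding K_def by auto
  have b_cont: "continuous_on UNIV b"
  proof -
    have "\<bar>L\<bar>-lipschitz_on UNIV b"
      by (rule lipschitz_onI) (simp_all add: dist_norm order_trans[OF lip mult_right_mono])
    then show "continuous_on UNIV b"
      by (rule lipschitz_on_continuous_on)
  qed
  \<comment> \<open>The unknown \<open>\<phi>\<close> is the weighted displacement: the candidate
    solution is \<open>x + exp (K * \<bar>s\<bar>) *\<^sub>R \<phi> s\<close>, so a possibly
    unbounded orbit is encoded by a bounded continuous function.\<close>
  define f where "f \<phi> s = b (x + exp (K * \<bar>s\<bar>) *\<^sub>R apply_bcontfun \<phi> s)" for \<phi> s
  have f_cont: "continuous_on UNIV (f \<phi>)" for \<phi>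
    unfolding f_def by (intro continuous_on_compose2[OF b_cont] continuous_intros) auto
  obtain F where F0: "\<And>\<phi>. F \<phi> 0 = 0"
    and F: "\<And>\<phi> t. (F \<phi> has_vector_derivative f \<phi> t) (at t)"
    using continuous_antiderivative[OF f_cont] by metis
  have "norm (f \<phi> t) \<le> M * exp (K * \<bar>t\<bar>)" for \<phi> t
  proof -
    have "M \<ge> 0" using bdd[of 0] norm_ge_zero order_trans by blast
    moreover have "1 \<le> exp (K * \<bar>t\<bar>)" using K by simp
    ultimately show ?thesis
      unfolding f_def by (metis bdd mult.right_neutral mult_left_mono order_trans)
  qed
  from exp_weighted_norm_bound[OF K(1) F0 F this]
  have F_bdd: "norm (F \<phi> t) \<le> M / K * exp (K * \<bar>t\<bar>)" for \<phi> t .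
  define g where "g \<phi> t = exp (- (K * \<bar>t\<bar>)) *\<^sub>R F \<phi> t" for \<phi> t
  have g_bdd: "norm (g \<phi> t) \<le> M / K" for \<phi> t
    using F_bdd[of \<phi> t] unfolding g_def by (simp add: exp_minus field_simps)
  have F_cont: "continuous_on UNIV (F \<phi>)" for \<phi>
    using F by (meson continuous_at_imp_continuous_on has_vector_derivative_continuous)
  have g_bcont: "g \<phi> \<in> bcontfun" for \<phi>
    using g_bdd unfolding bcontfun_def g_def
    by (auto intro!: continuous_intros F_cont boundedI)
  define T where "T \<phi> = Bcontfun (g \<phi>)" for \<phi>
  have T: "apply_bcontfun (T \<phi>) = g \<phi>" for \<phi>
    unfolding T_def by (rule Bcontfun_inverse[OF g_bcont])
  have "dist (T \<phi>) (T \<psi>) \<le> \<bar>L\<bar> / K * dist \<phi> \<psi>" for \<phi> \<psi>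
  proof (rule dist_bound)
    fix t
    have "norm (f \<phi> s - f \<psi> s) \<le> \<bar>L\<bar> * dist \<phi> \<psi> * exp (K * \<bar>s\<bar>)" for s
    proof -
      have "norm (f \<phi> s - f \<psi> s) \<le> L * norm (exp (K * \<bar>s\<bar>) *\<^sub>R (\<phi> s - \<psi> s))"
        unfolding f_def by (rule order_trans[OF lip]) (simp add: scaleR_diff_right)
      also have "\<dots> \<le> \<bar>L\<bar> * (exp (K * \<bar>s\<bar>) * dist (\<phi> s) (\<psi> s))"
        by (simp add: dist_norm mult_right_mono)
      also have "\<dots> \<le> \<bar>L\<bar> * (exp (K * \<bar>s\<bar>) * dist \<phi> \<psi>)"
        by (intro mult_left_mono dist_bounded) auto
      finally show ?thesis by (simp add: mult_ac)
    qed
    then have "norm (F \<phi> t - F \<psi> t) \<le> \<bar>L\<bar> * dist \<phi> \<psi> / K * exp (K * \<bar>t\<bar>)"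
      using F by (intro exp_weighted_norm_bound[OF K(1)])
        (auto simp: F0 intro!: derivative_intros)
    then have "exp (- (K * \<bar>t\<bar>)) * norm (F \<phi> t - F \<psi> t)
        \<le> exp (- (K * \<bar>t\<bar>)) * (\<bar>L\<bar> * dist \<phi> \<psi> / K * exp (K * \<bar>t\<bar>))"
      by (rule mult_left_mono) simp
    also have "\<dots> = \<bar>L\<bar> / K * dist \<phi> \<psi>"
      by (simp add: exp_minus)
    finally show "dist (T \<phi> t) (T \<psi> t) \<le> \<bar>L\<bar> / K * dist \<phi> \<psi>"
      unfolding T g_def dist_norm[of "_ *\<^sub>R _"] scaleR_diff_right[symmetric] norm_scaleR
      by simp
  qed
  then obtain \<phi> where "T \<phi> = \<phi>"
    using banach_fix_type[of "\<bar>L\<bar> / K" T] K by blast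
  \<comment> \<open>Removing the weight from the fixed point equation turns it into the integral
    form of the differential equation.\<close>
  then have "x + F \<phi> t = x + exp (K * \<bar>t\<bar>) *\<^sub>R \<phi> t" for t
    using T[of \<phi>] by (simp add: g_def exp_minus)
  then have "f \<phi> t = b (x + F \<phi> t)" for t
    unfolding f_def by simp
  moreover have "((\<lambda>t. x + F \<phi> t) has_vector_derivative f \<phi> t) (at t)" for t
    by (auto intro!: derivative_eq_intros F)
  ultimately show ?thesis
    by (intro exI[of _ "\<lambda>t. x + F \<phi> t"]) (simp add: F0)
qed

text \<open>For \<open>t \<ge> 0\<close> the squared distance times \<open>exp (- 2 * L * s)\<close>
  is nonincreasing; the inner product makes the squared norm differentiable. For
  \<open>t < 0\<close> the reversed curves solve the equation of \<open>- b\<close>, which has the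
  same Lipschitz constant. Both uniqueness and continuous dependence on the initial point
  follow.\<close>

lemma gronwall_two_solutions:
  fixes b :: "'a::real_inner \<Rightarrow> 'a"
  assumes lip: "\<And>x y. norm (b x - b y) \<le> L * norm (x - y)"
    and X: "\<And>t. (X has_vector_derivative b (X t)) (at t)"
    and Y: "\<And>t. (Y has_vector_derivative b (Y t)) (at t)"
  shows "norm (X t - Y t) \<le> exp (L * \<bar>t\<bar>) * norm (X 0 - Y 0)"
proof -
  have pos: "norm (X t - Y t) \<le> exp (L * t) * norm (X 0 - Y 0)"
    if "t \<ge> 0"
      and lip: "\<And>x y. norm (b x - b y) \<le> L * norm (x - y)"
      and X: "\<And>t. (X has_vector_derivative b (X t)) (at t)"
      and Y: "\<And>t. (Y has_vector_derivative b (Y t)) (at t)"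
    for t and b :: "'a \<Rightarrow> 'a" and X Y :: "real \<Rightarrow> 'a"
  proof -
    define u where "u s = X s - Y s" for s
    define w where "w s = exp (- 2 * L * s) * (u s \<bullet> u s)" for s
    define u' where "u' s = b (X s) - b (Y s)" for s
    have u: "(u has_vector_derivative u' s) (at s)" for s
      unfolding u_def u'_def by (intro derivative_intros X Y)
    have uu: "((\<lambda>s. u s \<bullet> u s) has_real_derivative 2 * (u s \<bullet> u' s)) (at s)" for s
      using has_derivative_inner[OF u[unfolded has_vector_derivative_def] u[unfolded has_vector_derivative_def]]
      unfolding has_field_derivative_def
      by (rule has_derivative_eq_rhs) (auto simp: inner_commute algebra_simps)
    have w: "(w has_real_derivative exp (- 2 * L * s) * (2 * (u s \<bullet> u' s) - 2 * L * (u s \<bullet> u s))) (at s)" for s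
      unfolding w_def by (auto intro!: derivative_eq_intros uu simp: algebra_simps)
    have le: "u s \<bullet> u' s \<le> L * (u s \<bullet> u s)" for s
    proof -
      have "u s \<bullet> u' s \<le> norm (u s) * norm (u' s)"
        by (rule norm_cauchy_schwarz)
      also have "\<dots> \<le> norm (u s) * (L * norm (u s))"
        unfolding u'_def u_def by (intro mult_left_mono lip) auto
      finally show ?thesis
        by (simp add: dot_square_norm power2_eq_square mult_ac)
    qed
    have "w t \<le> w 0"
    proof (rule DERIV_nonpos_imp_nonincreasing[OF \<open>t \<ge> 0\<close>])
      fix s
      have "exp (- 2 * L * s) * (2 * (u s \<bullet> u' s) - 2 * L * (u s \<bullet> u s)) \<le> 0"
        using le[of s] by (intro mult_nonneg_nonpos) simp_all
      then show "\<exists>y. (w has_real_derivative y) (at s) \<and> y \<le> 0"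
        using w by blast
    qed
    then have "norm (u t) ^ 2 \<le> (exp (L * t) * norm (u 0)) ^ 2"
      unfolding w_def by (simp add: dot_square_norm power_mult_distrib exp_minus field_simps flip: exp_double)
    then show ?thesis
      unfolding u_def by (rule power2_le_imp_le) simp
  qed
  show ?thesis
  proof (cases "t \<ge> 0")
    case True
    then show ?thesis using pos[OF _ lip X Y] by simp
  next
    case False
    have rev: "((\<lambda>t. Z (- t)) has_vector_derivative - b (Z (- s))) (at s)"
      if "\<And>t. (Z has_vector_derivative b (Z t)) (at t)" for Z s
      by (intro has_vector_derivative_reflect that)
    have "norm (- b x - - b y) \<le> L * norm (x - y)" for x y
      using lip[of x y] by (simp add: norm_minus_commute)
    from pos[OF _ this rev[OF X] rev[OF Y], of "-t"] False show ?thesis by simp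
  qed
qed

section \<open>A field that is constant on closed lines\<close>

definition C1_scalar :: "('a::real_normed_vector \<Rightarrow> real) \<Rightarrow> bool" where
  "C1_scalar f \<longleftrightarrow> (\<exists>D :: 'a \<Rightarrow> 'a \<Rightarrow>\<^sub>L real.
      (\<forall>x. (f has_derivative blinfun_apply (D x)) (at x)) \<and> continuous_on UNIV D)"

lemma C1_scalarI:
  assumes "\<And>x. (f has_derivative blinfun_apply (D x)) (at x)" "continuous_on UNIV D"
  shows "C1_scalar f"
  using assms unfolding C1_scalar_def by blast

lemma C1_scalarE:
  assumes "C1_scalar f"
  obtains D where "\<And>x. (f has_derivative blinfun_apply (D x)) (at x)" "continuous_on UNIV D"
  using assms unfolding C1_scalar_def by blast

lemma C1_scalar_continuous: "C1_scalar f \<Longrightarrow> continuous_on A f"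
  unfolding C1_scalar_def
  by (meson continuous_at_imp_continuous_on has_derivative_continuous)

lemma C1_scalar_const: "C1_scalar (\<lambda>x. c)"
  by (rule C1_scalarI[of _ "\<lambda>x. 0"]) (auto intro!: derivative_eq_intros)

lemma C1_scalar_add:
  assumes "C1_scalar f" "C1_scalar g"
  shows "C1_scalar (\<lambda>x. f x + g x)"
proof -
  obtain Df Dg where
    "\<And>x. (f has_derivative blinfun_apply (Df x)) (at x)" "continuous_on UNIV Df"
    "\<And>x. (g has_derivative blinfun_apply (Dg x)) (at x)" "continuous_on UNIV Dg"
    using assms by (metis C1_scalarE)
  then show ?thesis
    by (intro C1_scalarI[of _ "\<lambda>x. Df x + Dg x"])
      (auto intro!: derivative_eq_intros continuous_intros simp: blinfun.bilinear_simps)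
qed

lemma C1_scalar_mult:
  assumes "C1_scalar f" "C1_scalar g"
  shows "C1_scalar (\<lambda>x. f x * g x)"
proof -
  obtain Df Dg where
    "\<And>x. (f has_derivative blinfun_apply (Df x)) (at x)" "continuous_on UNIV Df"
    "\<And>x. (g has_derivative blinfun_apply (Dg x)) (at x)" "continuous_on UNIV Dg"
    using assms by (metis C1_scalarE)
  then show ?thesis
    by (intro C1_scalarI[of _ "\<lambda>x. f x *\<^sub>R Dg x + g x *\<^sub>R Df x"])
      (auto intro!: derivative_eq_intros continuous_intros C1_scalar_continuous assms
        simp: blinfun.bilinear_simps)
qed

text \<open>The outer function is controlled only on the range of \<open>g\<close>, so that the rule
  covers the reciprocal of a function without zeros.\<close>

lemma C1_scalar_compose:
  assumes h: "\<And>x. (h has_real_derivative h' (g x)) (at (g x))" "continuous_on (range g) h'"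
    and "C1_scalar g"
  shows "C1_scalar (\<lambda>x. h (g x))"
proof -
  obtain D where D: "\<And>x. (g has_derivative blinfun_apply (D x)) (at x)" "continuous_on UNIV D"
    using assms(3) unfolding C1_scalar_def by blast
  have "((\<lambda>x. h (g x)) has_derivative blinfun_apply (h' (g x) *\<^sub>R D x)) (at x)" for x
    using has_derivative_compose[OF D(1) h(1)[unfolded has_field_derivative_def]]
    by (rule has_derivative_eq_rhs) (simp add: blinfun.bilinear_simps fun_eq_iff)
  moreover have "continuous_on UNIV (\<lambda>x. h' (g x) *\<^sub>R D x)"
    by (intro continuous_intros D continuous_on_compose2[OF h(2)] C1_scalar_continuous assms) auto
  ultimately show ?thesis
    by (rule C1_scalarI)
qed

lemma C1_scalar_inverse:
  assumes "C1_scalar g" "\<And>x. g x \<noteq> 0"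
  shows "C1_scalar (\<lambda>x. inverse (g x))"
proof (rule C1_scalar_compose[OF _ _ assms(1)])
  show "(inverse has_real_derivative - (inverse (g x) ^ 2)) (at (g x))" for x
    using DERIV_inverse[OF assms(2)] by (simp add: numeral_2_eq_2)
  show "continuous_on (range g) (\<lambda>y. - (inverse y ^ 2))"
    by (intro continuous_intros) (use assms(2) in auto)
qed

lemma C1_scalar_sum: "(\<And>i. i \<in> I \<Longrightarrow> C1_scalar (f i)) \<Longrightarrow> C1_scalar (\<lambda>x. \<Sum>i\<in>I. f i x)"
  by (induction I rule: infinite_finite_induct) (simp_all add: C1_scalar_const C1_scalar_add)

lemma C1_scalar_prod: "(\<And>i. i \<in> I \<Longrightarrow> C1_scalar (f i)) \<Longrightarrow> C1_scalar (\<lambda>x. \<Prod>i\<in>I. f i x)"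
  by (induction I rule: infinite_finite_induct) (simp_all add: C1_scalar_const C1_scalar_mult)

lemma C1_scalar_affine:
  assumes "bounded_linear f"
  shows "C1_scalar (\<lambda>x. f (x - a))"
proof (rule C1_scalarI)
  show "((\<lambda>x. f (x - a)) has_derivative blinfun_apply (Blinfun f)) (at x)" for x
    by (simp add: bounded_linear_Blinfun_apply assms)
      (auto intro!: derivative_eq_intros bounded_linear.has_derivative[OF assms])
  show "continuous_on UNIV (\<lambda>x. Blinfun f)"
    by simp
qed

text \<open>The vectors are constant, so the derivative is a sum of rank-one maps depending
  continuously on the point.\<close>

lemma C1_on_R3_sum_scaleR:
  assumes "\<And>v. v \<in> S \<Longrightarrow> C1_scalar (\<phi> v)"
  shows "C1_on_R3 (\<lambda>x. \<Sum>v\<in>S. \<phi> v x *\<^sub>R v)"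
proof -
  obtain D where D: "\<And>v x. v \<in> S \<Longrightarrow> (\<phi> v has_derivative blinfun_apply (D v x)) (at x)"
    "\<And>v. v \<in> S \<Longrightarrow> continuous_on UNIV (D v)"
    using assms unfolding C1_scalar_def by metis
  define E where "E x = (\<Sum>v\<in>S. blinfun_scaleR_left v o\<^sub>L D v x)" for x
  have "((\<lambda>x. \<Sum>v\<in>S. \<phi> v x *\<^sub>R v) has_derivative blinfun_apply (E x)) (at x)" for x
  proof -
    have "((\<lambda>x. \<Sum>v\<in>S. \<phi> v x *\<^sub>R v) has_derivative (\<lambda>h. \<Sum>v\<in>S. D v x h *\<^sub>R v)) (at x)"
      by (intro derivative_intros D)
    then show ?thesis
      by (rule has_derivative_eq_rhs) (simp add: E_def blinfun.sum_left fun_eq_iff)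
  qed
  moreover have "continuous_on UNIV E"
    unfolding E_def by (intro continuous_intros D)
  ultimately show ?thesis
    unfolding C1_on_R3_def by blast
qed

section \<open>Integer vectors and reduction modulo the lattice\<close>

definition int_part :: "vec3 \<Rightarrow> vec3" where
  "int_part x = (\<chi> i. of_int \<lfloor>x $ i\<rfloor>)"

lemma int_vec_int_part: "int_vec (int_part x)"
  by (simp add: int_vec_def int_part_def)

lemma unit_cell_diff_int_part: "x - int_part x \<in> unit_cell"
  unfolding unit_cell_def int_part_def by (auto simp: le_floor_iff) linarith

lemma int_vec_minus: "int_vec x \<Longrightarrow> int_vec (- x)"
  by (simp add: int_vec_def)

lemma inner_cross3_left: "cross3 x y \<bullet> z = x \<bullet> cross3 y z"
  by (simp add: cross3_simps)

lemma int_vec_cross: "int_vec x \<Longrightarrow> int_vec y \<Longrightarrow> int_vec (cross3 x y)"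
  by (simp add: int_vec_def forall_3 cross3_def)

lemma int_vec_inner: "int_vec x \<Longrightarrow> int_vec y \<Longrightarrow> x \<bullet> y \<in> \<int>"
  by (simp add: int_vec_def inner_vec_def sum_3)

text \<open>Multiplying by the common denominator \<open>N\<close> gives an integer vector parallel
  to \<open>v\<close>. For \<open>v = 0\<close> any integer direction serves, with speed
  \<open>r = 0\<close>: the corresponding lines will consist of rest points.\<close>

lemma rat_vec_direction:
  assumes "rat_vec v"
  shows "\<exists>\<xi> r. int_vec \<xi> \<and> \<xi> \<noteq> 0 \<and> v = r *\<^sub>R \<xi>"
proof (cases "v = 0")
  case True
  have "int_vec (axis 1 1)" "axis 1 1 \<noteq> (0 :: vec3)"
    by (simp_all add: int_vec_def axis_def vec_eq_iff)
  with True show ?thesis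
    by (intro exI[of _ "axis 1 1"] exI[of _ 0]) simp
next
  case False
  have denominator: "\<exists>q. q \<noteq> 0 \<and> real_of_int q * v $ i \<in> \<int>" for i
  proof -
    obtain p q where "q \<noteq> 0" "v $ i = real_of_int p / real_of_int q"
      using assms unfolding rat_vec_def Rats_eq_int_div_int by blast
    then show ?thesis by (intro exI[of _ q]) simp
  qed
  obtain a b c where q: "a \<noteq> 0" "b \<noteq> 0" "c \<noteq> 0"
    and int: "real_of_int a * v $ 1 \<in> \<int>" "real_of_int b * v $ 2 \<in> \<int>" "real_of_int c * v $ 3 \<in> \<int>"
    using denominator[of 1] denominator[of 2] denominator[of 3] by blast
  define N where "N = real_of_int a * real_of_int b * real_of_int c"
  have "N * v $ 1 = real_of_int (b * c) * (real_of_int a * v $ 1)"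
    "N * v $ 2 = real_of_int (a * c) * (real_of_int b * v $ 2)"
    "N * v $ 3 = real_of_int (a * b) * (real_of_int c * v $ 3)"
    by (simp_all add: N_def)
  then have "int_vec (N *\<^sub>R v)"
    unfolding int_vec_def forall_3 using int by (simp only: vector_scaleR_component Ints_mult Ints_of_int real_scaleR_def)
  moreover have "N \<noteq> 0"
    using q by (simp add: N_def)
  ultimately show ?thesis
    using False by (intro exI[of _ "N *\<^sub>R v"] exI[of _ "1 / N"]) simp
qed

lemma periodic3_diff_int_part:
  assumes "periodic3 f"
  shows "f (x - int_part x) = f x"
  using assms int_vec_minus[OF int_vec_int_part[of x]] unfolding periodic3_def
  by (metis add_uminus_conv_diff)

lemma unit_cell_subset: "unit_cell \<subseteq> cbox 0 1"
  by (auto simp: unit_cell_def mem_box_cart less_imp_le)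

text \<open>All values are already taken on the compact unit cube.\<close>

lemma periodic3_continuous_bounded:
  fixes f :: "vec3 \<Rightarrow> 'b::real_normed_vector"
  assumes "periodic3 f" "continuous_on UNIV f"
  obtains B where "\<And>x. norm (f x) \<le> B"
proof -
  have "compact (f ` cbox 0 1)"
    using assms(2) by (intro compact_continuous_image continuous_on_subset[OF assms(2)]) auto
  then obtain B where "\<And>y. y \<in> f ` cbox 0 1 \<Longrightarrow> norm y \<le> B"
    by (metis compact_imp_bounded bounded_iff)
  then have "norm (f x) \<le> B" for x
    using periodic3_diff_int_part[OF assms(1), of x] unit_cell_diff_int_part[of x] unit_cell_subset
    by (metis image_eqI subsetD)
  then show thesis ..
qed

text \<open>The derivative inherits periodicity because derivatives are unique; being continuous it
  is then bounded, and the mean value inequality applies.\<close>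

lemma periodic3_C1_lipschitz:
  assumes "periodic3 b" "C1_on_R3 b"
  obtains L where "\<And>x y. norm (b x - b y) \<le> L * norm (x - y)"
proof -
  obtain D where D: "\<And>x. (b has_derivative blinfun_apply (D x)) (at x)" "continuous_on UNIV D"
    using assms(2) unfolding C1_on_R3_def by blast
  have "D (x + k) = D x" if "int_vec k" for x k
  proof -
    have "((\<lambda>x. x + k) has_derivative (\<lambda>h. h)) (at x)"
      by (auto intro!: derivative_eq_intros)
    from has_derivative_compose[OF this D(1)]
    have "((\<lambda>x. b (x + k)) has_derivative blinfun_apply (D (x + k))) (at x)" .
    moreover have "(\<lambda>x. b (x + k)) = b"
      using assms(1) that by (auto simp: periodic3_def)
    ultimately show ?thesis
      using D(1) has_derivative_unique by (metis blinfun_eqI)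
  qed
  then have "periodic3 D"
    by (simp add: periodic3_def)
  then obtain L where L: "\<And>x. norm (D x) \<le> L"
    using periodic3_continuous_bounded D(2) by blast
  have "norm (b x - b y) \<le> L * norm (x - y)" for x y
    by (rule differentiable_bound[of UNIV b "\<lambda>x. blinfun_apply (D x)"])
      (use D(1) L in \<open>auto simp: norm_blinfun.rep_eq[symmetric]\<close>)
  then show thesis ..
qed

section \<open>Closed lines and their generic position\<close>

text \<open>The preimage in \<open>\<real>\<^sup>3\<close> of finitely many parallel closed orbits of the torus with direction \<open>\<xi>\<close>.\<close>
definition closed_lines :: "vec3 \<Rightarrow> vec3 \<Rightarrow> vec3 set" where
  "closed_lines \<xi> a = {x. int_vec (cross3 \<xi> (x - a))}"

text \<open>A nonnegative trigonometric polynomial whose zero set is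
  \<open>closed_lines \<xi> a\<close>: a summand vanishes exactly when its coordinate of the cross
  product is an integer.\<close>

definition line_fun :: "vec3 \<Rightarrow> vec3 \<Rightarrow> vec3 \<Rightarrow> real" where
  "line_fun \<xi> a x = (\<Sum>i\<in>UNIV. 1 - cos (2 * pi * (cross3 \<xi> (x - a)) $ i))"

lemma line_fun_nonneg: "line_fun \<xi> a x \<ge> 0"
  by (simp add: line_fun_def sum_nonneg)

lemma line_fun_eq_0_iff: "line_fun \<xi> a x = 0 \<longleftrightarrow> x \<in> closed_lines \<xi> a"
proof -
  have "cos (2 * pi * r) = 1 \<longleftrightarrow> r \<in> \<int>" for r
    unfolding cos_one_2pi_int by (auto simp: Ints_def mult_ac)
  then show ?thesis
    unfolding line_fun_def closed_lines_def int_vec_def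
    by (subst sum_nonneg_eq_0_iff) (auto simp: eq_commute[of 1])
qed

lemma line_fun_periodic:
  assumes "int_vec \<xi>"
  shows "periodic3 (line_fun \<xi> a)"
proof -
  have "cos (2 * pi * (r + m)) = cos (2 * pi * r)" if "m \<in> \<int>" for r m
    using that by (auto simp: Ints_def distrib_left cos_add)
  moreover have "cross3 \<xi> (x + k - a) = cross3 \<xi> (x - a) + cross3 \<xi> k" for x k
    by (simp add: cross_add_right[symmetric] algebra_simps)
  ultimately show ?thesis
    using int_vec_cross[OF assms] by (simp add: periodic3_def line_fun_def int_vec_def)
qed

lemma line_fun_C1: "C1_scalar (line_fun \<xi> a)"
proof -
  have "C1_scalar (\<lambda>x. 1 - cos (2 * pi * (cross3 \<xi> (x - a)) $ i))" for i
  proof (rule C1_scalar_compose[of "\<lambda>t. 1 - cos (2 * pi * t)" "\<lambda>t. 2 * pi * sin (2 * pi * t)"])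
    have "linear (\<lambda>x. (cross3 \<xi> x) $ i)"
      by (rule linearI) (simp_all add: cross_add_right cross_mult_right)
    then show "C1_scalar (\<lambda>x. (cross3 \<xi> (x - a)) $ i)"
      by (rule C1_scalar_affine[OF linear_conv_bounded_linear[THEN iffD1]])
  qed (auto intro!: derivative_eq_intros continuous_intros)
  then show ?thesis
    unfolding line_fun_def by (rule C1_scalar_sum)
qed

text \<open>The vectors to avoid lie on countably many hyperplanes \<open>w \<bullet> u = q\<close>,
  each of measure zero.\<close>

lemma exists_generic_vector:
  obtains u :: vec3 where "\<And>w. int_vec w \<Longrightarrow> w \<noteq> 0 \<Longrightarrow> w \<bullet> u \<notin> \<rat>"
proof -
  define N where "N = (SIGMA w:{w. int_vec w \<and> w \<noteq> 0}. (\<rat> :: real set))"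
  have "Collect int_vec \<subseteq> range (\<lambda>(i, j, k). vector [of_int i, of_int j, of_int k])"
  proof
    fix w assume "w \<in> Collect int_vec"
    then obtain i j k :: int where "w $ 1 = of_int i" "w $ 2 = of_int j" "w $ 3 = of_int k"
      unfolding int_vec_def Ints_def by blast
    then have "w = (\<lambda>(i, j, k). vector [of_int i, of_int j, of_int k]) (i, j, k)"
      by (simp add: vec_eq_iff forall_3)
    then show "w \<in> range (\<lambda>(i, j, k). vector [of_int i, of_int j, of_int k])"
      by blast
  qed
  then have "countable (Collect int_vec)"
    by (rule countable_subset) simp
  then have "countable N"
    unfolding N_def by (intro countable_SIGMA countable_rat) (auto intro: countable_subset[rotated])
  then have "negligible (\<Union>(w, q)\<in>N. {u. w \<bullet> u = q})"
    by (intro negligible_countable_Union) (auto simp: N_def intro: negligible_hyperplane)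
  then have "(\<Union>(w, q)\<in>N. {u. w \<bullet> u = q}) \<noteq> UNIV"
    using non_negligible_UNIV by metis
  then show thesis
    using that unfolding N_def by fastforce
qed

text \<open>At a common point \<open>x\<close>, some nonzero integer \<open>w\<close> has integer
  inner product with both \<open>x - real m *\<^sub>R u\<close> and
  \<open>x - real n *\<^sub>R u\<close>. Subtracting makes
  \<open>(real m - real n) * (w \<bullet> u)\<close> rational, against the choice of
  \<open>u\<close>.\<close>

lemma closed_lines_disjoint:
  assumes u: "\<And>w. int_vec w \<Longrightarrow> w \<noteq> 0 \<Longrightarrow> w \<bullet> u \<notin> \<rat>"
    and int: "int_vec \<xi>" "int_vec \<eta>" and nz: "\<xi> \<noteq> 0" "\<eta> \<noteq> 0" and "m \<noteq> (n::nat)"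
  shows "closed_lines \<xi> (real m *\<^sub>R u) \<inter> closed_lines \<eta> (real n *\<^sub>R u) = {}"
proof (rule ccontr)
  assume "closed_lines \<xi> (real m *\<^sub>R u) \<inter> closed_lines \<eta> (real n *\<^sub>R u) \<noteq> {}"
  then obtain x where x: "int_vec (cross3 \<xi> (x - real m *\<^sub>R u))" "int_vec (cross3 \<eta> (x - real n *\<^sub>R u))"
    unfolding closed_lines_def by blast
  have contra: False if "int_vec w" "w \<noteq> 0"
    and "w \<bullet> (x - real m *\<^sub>R u) \<in> \<int>" "w \<bullet> (x - real n *\<^sub>R u) \<in> \<int>" for w
  proof -
    have "w \<bullet> (x - real n *\<^sub>R u) - w \<bullet> (x - real m *\<^sub>R u) \<in> \<int>"
      using that by (intro Ints_diff)
    then have "(real m - real n) * (w \<bullet> u) \<in> \<rat>"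
      using Ints_subset_Rats by (auto simp: inner_diff_right algebra_simps)
    moreover have "real m - real n \<in> \<rat>" "real m - real n \<noteq> 0"
      using \<open>m \<noteq> n\<close> by auto
    ultimately have "(real m - real n) * (w \<bullet> u) / (real m - real n) \<in> \<rat>"
      by (intro Rats_divide)
    then show False
      using \<open>real m - real n \<noteq> 0\<close> u that(1,2) by simp
  qed
  show False
  proof (cases "cross3 \<xi> \<eta> = 0")
    case False
    \<comment> \<open>For directions that are not parallel take
      \<open>w = cross3 \<xi> \<eta>\<close>: the scalar triple product rewrites each inner product
      as one of integer vectors, up to sign.\<close>
    show False
    proof (rule contra)
      show "int_vec (cross3 \<xi> \<eta>)" "cross3 \<xi> \<eta> \<noteq> 0"
        using int_vec_cross[OF int] False by blast+
      show "cross3 \<xi> \<eta> \<bullet> (x - real m *\<^sub>R u) \<in> \<int>"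
        unfolding cross_skew[of \<xi> \<eta>] inner_minus_left inner_cross3_left
        by (intro Ints_minus int_vec_inner int x)
      show "cross3 \<xi> \<eta> \<bullet> (x - real n *\<^sub>R u) \<in> \<int>"
        unfolding inner_cross3_left by (intro int_vec_inner int x)
    qed
  next
    case True
    \<comment> \<open>For parallel directions
      \<open>\<eta> $ j *\<^sub>R \<xi> = \<xi> $ j *\<^sub>R \<eta>\<close>, so crossing with a
      basis vector not parallel to \<open>\<xi>\<close> gives one \<open>w\<close> that is an
      integer multiple of both cross products. It is nonzero because
      \<open>\<eta> $ j \<noteq> 0\<close>.\<close>
    obtain j where j: "\<eta> $ j \<noteq> 0"
      using nz by (auto simp: vec_eq_iff)
    obtain i where i: "cross3 (axis i 1) \<xi> \<noteq> 0"
      using cross_basis_nonzero[of \<xi>] nz by (metis cross_skew neg_equal_0_iff_equal)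
    have eq: "\<eta> $ j *\<^sub>R \<xi> = \<xi> $ j *\<^sub>R \<eta>"
      using True exhaust_3[of j] by (auto simp: cross3_simps forall_3)
    define w where "w = \<eta> $ j *\<^sub>R cross3 (axis i 1) \<xi>"
    have w: "w = \<xi> $ j *\<^sub>R cross3 (axis i 1) \<eta>"
      unfolding w_def cross_mult_right[symmetric] eq ..
    have axis: "int_vec (axis i 1)"
      by (simp add: int_vec_def axis_def)
    have "int_vec w" "w \<noteq> 0"
      using int_vec_cross[OF axis int(1)] int(2) i j unfolding w_def by (auto simp: int_vec_def)
    moreover have "w \<bullet> (x - real m *\<^sub>R u) = \<eta> $ j * (axis i 1 \<bullet> cross3 \<xi> (x - real m *\<^sub>R u))"
      unfolding w_def by (simp add: inner_cross3_left)
    then have "w \<bullet> (x - real m *\<^sub>R u) \<in> \<int>"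
      using int_vec_inner[OF axis x(1)] int(2) by (simp add: int_vec_def)
    moreover have "w \<bullet> (x - real n *\<^sub>R u) = \<xi> $ j * (axis i 1 \<bullet> cross3 \<eta> (x - real n *\<^sub>R u))"
      unfolding w by (simp add: inner_cross3_left)
    then have "w \<bullet> (x - real n *\<^sub>R u) \<in> \<int>"
      using int_vec_inner[OF axis x(2)] int(1) by (simp add: int_vec_def)
    ultimately show False by (rule contra)
  qed
qed

lemma closed_lines_add:
  assumes "x \<in> closed_lines \<xi> a"
  shows "x + t *\<^sub>R \<xi> \<in> closed_lines \<xi> a"
proof -
  have "cross3 \<xi> (x + t *\<^sub>R \<xi> - a) = cross3 \<xi> (x - a)"
    by (simp add: Cross3.right_diff_distrib cross_add_right cross_mult_right)
  with assms show ?thesis by (simp add: closed_lines_def)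
qed

section \<open>Invariant measures\<close>

text \<open>With an antiderivative \<open>F\<close> the integral is \<open>F (c + 1) - F c\<close>,
  whose derivative in \<open>c\<close> vanishes by periodicity. This is the invariance of the
  uniform measure on a closed orbit.\<close>

lemma integral_periodic_shift:
  fixes h :: "real \<Rightarrow> real"
  assumes cont: "continuous_on UNIV h" and per: "\<And>s. h (s + 1) = h s"
  shows "(LBINT s:{0..1}. h (s + c)) = (LBINT s:{0..1}. h s)"
proof -
  obtain F where F: "\<And>t. (F has_real_derivative h t) (at t)"
    using continuous_antiderivative[OF cont]
    unfolding has_real_derivative_iff_has_vector_derivative[symmetric] by blast
  have F_shift: "((\<lambda>s. F (s + c)) has_real_derivative h (s + c)) (at s within A)" for s c A
  proof -
    have "((\<lambda>s. s + c) has_real_derivative 1) (at s within A)"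
      by (auto intro!: derivative_eq_intros)
    from DERIV_chain2[OF F this] show ?thesis by simp
  qed
  have eq: "(LBINT s:{0..1}. h (s + c)) = F (1 + c) - F c" for c
  proof -
    have "set_integrable lborel {0..1} (\<lambda>s. h (s + c))"
      by (intro borel_integrable_atLeastAtMost' continuous_intros continuous_on_compose2[OF cont]) auto
    then have "(LBINT s:{0..1}. h (s + c)) = integral {0..1} (\<lambda>s. h (s + c))"
      by (rule set_borel_integral_eq_integral)
    moreover have "((\<lambda>s. h (s + c)) has_integral (F (1 + c) - F (0 + c))) {0..1}"
    proof (rule fundamental_theorem_of_calculus)
      fix s :: real
      show "((\<lambda>s. F (s + c)) has_vector_derivative h (s + c)) (at s within {0..1})"
        using F_shift by (simp add: has_real_derivative_iff_has_vector_derivative)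
    qed simp
    ultimately show ?thesis
      by (simp add: integral_unique)
  qed
  have "((\<lambda>c. F (c + 1) - F c) has_real_derivative h (c + 1) - h c) (at c)" for c
    by (intro DERIV_diff F_shift F)
  then have "((\<lambda>c. F (c + 1) - F c) has_real_derivative 0) (at c)" for c
    by (simp only: per diff_self)
  then have "F (c + 1) - F c = F (0 + 1) - F 0"
    by (intro DERIV_isconst_all[of "\<lambda>c. F (c + 1) - F c"]) blast
  then show ?thesis
    using eq[of c] eq[of 0] by (simp add: add.commute)
qed

section \<open>Probability measures carried by closed orbits\<close>

lemma borel_measurable_diff_int_part: "(\<lambda>x. x - int_part x) \<in> borel_measurable borel"
proof -
  have "(\<lambda>x. (x - int_part x) \<bullet> e) \<in> borel_measurable borel" if e: "e \<in> Basis" for e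
  proof -
    obtain i where "e = axis i 1"
      using e unfolding Basis_vec_def by auto
    then show ?thesis
      by (simp add: int_part_def inner_axis) measurable
  qed
  then show ?thesis
    using borel_measurable_euclidean_space by blast
qed

lemma unit_cell_borel: "unit_cell \<in> sets borel"
proof -
  have "unit_cell = (\<Inter>i. {y. 0 \<le> y $ i} \<inter> {y. y $ i < 1})"
    by (auto simp: unit_cell_def)
  also have "\<dots> \<in> sets borel"
    by measurable
  finally show ?thesis .
qed

text \<open>The \<open>c\<close>-weighted mixture of the uniform measures on the closed orbits
  through \<open>a v\<close> with direction \<open>\<xi> v\<close>.\<close>
definition orbit_mixture ::
    "vec3 set \<Rightarrow> (vec3 \<Rightarrow> real) \<Rightarrow> (vec3 \<Rightarrow> vec3) \<Rightarrow> (vec3 \<Rightarrow> vec3) \<Rightarrow> vec3 measure" where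
  "orbit_mixture S c a \<xi> =
     distr (point_measure S (\<lambda>v. ennreal (c v)) \<Otimes>\<^sub>M restrict_space lborel {0..1::real}) borel
       (\<lambda>(v, s). a v + s *\<^sub>R \<xi> v - int_part (a v + s *\<^sub>R \<xi> v))"

text \<open>The weights on \<open>S\<close> and the uniform law on the unit interval form a product
  probability space, pushed into the cell by reduction modulo integers. Fubini with a finite first
  factor turns a mean into a weighted sum of orbit means; the bound \<open>B\<close> supplies
  integrability.\<close>

lemma
  fixes S :: "vec3 set" and a \<xi> :: "vec3 \<Rightarrow> vec3"
  assumes "finite S" and c: "\<forall>v\<in>S. c v \<ge> 0" "(\<Sum>v\<in>S. c v) = 1"
  shows torus_prob_orbit_mixture: "torus_prob (orbit_mixture S c a \<xi>)"
    and integral_orbit_mixture: "\<And>(f :: vec3 \<Rightarrow> 'b::euclidean_space) B.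
      f \<in> borel_measurable borel \<Longrightarrow> (\<And>x. norm (f x) \<le> B) \<Longrightarrow>
      (\<integral>y. f y \<partial>orbit_mixture S c a \<xi>) = (\<Sum>v\<in>S. c v *\<^sub>R (LBINT s:{0..1}.
        f (a v + s *\<^sub>R \<xi> v - int_part (a v + s *\<^sub>R \<xi> v))))"
proof -
  define P where "P = point_measure S c"
  define U where "U = restrict_space lborel {0..1::real}"
  define q where "q = (\<lambda>(v, s). a v + s *\<^sub>R \<xi> v - int_part (a v + s *\<^sub>R \<xi> v))"
  let ?\<mu> = "orbit_mixture S c a \<xi>"
  have \<mu>: "?\<mu> = distr (P \<Otimes>\<^sub>M U) borel q"
    unfolding orbit_mixture_def P_def U_def q_def ..
  interpret P: prob_space P
    unfolding P_def using assms
    by (intro prob_spaceI) (simp add: space_point_measure emeasure_point_measure_finite sum_ennreal)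
  interpret U: prob_space U
    unfolding U_def by (intro prob_spaceI) (simp add: space_restrict_space emeasure_restrict_space)
  interpret PU: pair_prob_space P U ..
  \<comment> \<open>Since \<open>S\<close> is finite, measurability of each slice in
    \<open>s\<close> gives joint measurability.\<close>
  have "(\<lambda>s. q (v, s)) \<in> borel_measurable U" for v
  proof -
    have "(\<lambda>s. a v + s *\<^sub>R \<xi> v) \<in> borel_measurable U"
      unfolding U_def by (intro measurable_restrict_space1) simp
    from measurable_compose[OF this borel_measurable_diff_int_part] show ?thesis
      by (simp add: q_def)
  qed
  then have "q \<in> borel_measurable (count_space S \<Otimes>\<^sub>M U)"
    using \<open>finite S\<close> by (intro measurable_pair_measure_countable1) (auto simp: countable_finite)
  moreover have "sets (P \<Otimes>\<^sub>M U) = sets (count_space S \<Otimes>\<^sub>M U)"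
    by (intro sets_pair_measure_cong) (simp_all add: P_def sets_point_measure)
  ultimately have q: "q \<in> borel_measurable (P \<Otimes>\<^sub>M U)"
    using measurable_cong_sets by blast
  have "prob_space ?\<mu>"
    unfolding \<mu> by (rule PU.prob_space_distr[OF q])
  moreover have "emeasure ?\<mu> unit_cell = 1"
  proof -
    have "q -` unit_cell \<inter> space (P \<Otimes>\<^sub>M U) = space (P \<Otimes>\<^sub>M U)"
      using unit_cell_diff_int_part by (auto simp: q_def)
    then show ?thesis
      unfolding \<mu> by (simp add: emeasure_distr[OF q unit_cell_borel] PU.emeasure_space_1)
  qed
  ultimately show "torus_prob ?\<mu>"
    by (simp add: torus_prob_def \<mu>)
  show "(\<integral>y. f y \<partial>?\<mu>) = (\<Sum>v\<in>S. c v *\<^sub>R (LBINT s:{0..1}.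
        f (a v + s *\<^sub>R \<xi> v - int_part (a v + s *\<^sub>R \<xi> v))))"
    if f: "f \<in> borel_measurable borel" and B: "\<And>x. norm (f x) \<le> B"
    for f :: "vec3 \<Rightarrow> 'b::euclidean_space" and B
  proof -
    have "integrable (P \<Otimes>\<^sub>M U) (\<lambda>p. f (q p))"
      using B measurable_compose[OF q f] by (intro PU.integrable_const_bound[of _ B]) auto
    then have "(\<integral>y. f y \<partial>?\<mu>) = (\<integral>v. (\<integral>s. f (q (v, s)) \<partial>U) \<partial>P)"
      unfolding \<mu> by (simp add: integral_distr[OF q f] PU.integral_fst'[symmetric])
    also have "\<dots> = (\<Sum>v\<in>S. c v *\<^sub>R (\<integral>s. f (q (v, s)) \<partial>U))"
      unfolding P_def using assms by (simp add: lebesgue_integral_point_measure_finite)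
    also have "\<dots> = (\<Sum>v\<in>S. c v *\<^sub>R (LBINT s:{0..1}. f (q (v, s))))"
      unfolding U_def set_lebesgue_integral_def by (simp add: integral_restrict_space)
    finally show ?thesis
      by (simp add: q_def)
  qed
qed

section \<open>The flow of a periodic field\<close>

lemma is_flow_exists:
  assumes "periodic3 b" "C1_on_R3 b"
  shows "\<exists>X. is_flow b X"
proof -
  obtain L where L: "\<And>x y. norm (b x - b y) \<le> L * norm (x - y)"
    using periodic3_C1_lipschitz[OF assms] by blast
  have "continuous_on UNIV b"
    using assms(2) unfolding C1_on_R3_def
    by (meson continuous_at_imp_continuous_on has_derivative_continuous)
  then obtain M where "\<And>x. norm (b x) \<le> M"
    using periodic3_continuous_bounded assms(1) by blast
  from lipschitz_bounded_global_solution[OF L this]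
  have "\<exists>Y. \<forall>x. Y x 0 = x \<and> (\<forall>t. (Y x has_vector_derivative b (Y x t)) (at t))"
    by metis
  then obtain Y where "\<And>x. Y x 0 = x" "\<And>x t. (Y x has_vector_derivative b (Y x t)) (at t)"
    by blast
  then have "is_flow b (\<lambda>t x. Y x t)"
    by (simp add: is_flow_def)
  then show ?thesis by blast
qed

text \<open>By the Gronwall estimate the time-\<open>t\<close> map is Lipschitz; its continuity
  makes \<open>\<psi> (X t y)\<close> Borel measurable in \<open>y\<close>.\<close>

lemma is_flow_continuous:
  assumes lip: "\<And>x y. norm (b x - b y) \<le> L * norm (x - y)" and "is_flow b X"
  shows "continuous_on UNIV (X t)"
proof -
  have "norm (X t x - X t y) \<le> exp (L * \<bar>t\<bar>) * norm (x - y)" for x y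
    using gronwall_two_solutions[OF lip, of "\<lambda>s. X s x" "\<lambda>s. X s y" t] assms(2)
    by (simp add: is_flow_def)
  then have "(exp (L * \<bar>t\<bar>))-lipschitz_on UNIV (X t)"
    by (intro lipschitz_onI) (auto simp: dist_norm)
  then show ?thesis
    by (rule lipschitz_on_continuous_on)
qed

lemma is_flow_unique:
  assumes lip: "\<And>x y. norm (b x - b y) \<le> L * norm (x - y)" and "is_flow b X"
    and "Y 0 = x" "\<And>t. (Y has_vector_derivative b (Y t)) (at t)"
  shows "X t x = Y t"
  using gronwall_two_solutions[OF lip, of "\<lambda>s. X s x" Y t] assms(2-4) by (simp add: is_flow_def)

section \<open>The two inclusions between the rotation set and the convex hull\<close>

text \<open>The means of the weights \<open>\<phi> v\<close> are themselves convex coefficients, and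
  by linearity they represent the mean of \<open>b\<close>.\<close>

lemma rotation_set_subset_convex_hull:
  assumes "finite S" and b: "\<And>x. b x = (\<Sum>v\<in>S. \<phi> v x *\<^sub>R v)"
    and \<phi>: "\<And>v x. v \<in> S \<Longrightarrow> \<phi> v x \<ge> 0" "\<And>x. (\<Sum>v\<in>S. \<phi> v x) = 1"
      "\<And>v. v \<in> S \<Longrightarrow> continuous_on UNIV (\<phi> v)"
  shows "rotation_set b X \<subseteq> convex hull S"
proof
  fix z assume "z \<in> rotation_set b X"
  then obtain \<mu> where z: "z = (\<integral>y. b y \<partial>\<mu>)" and \<mu>: "torus_prob \<mu>"
    unfolding rotation_set_def invariant_measure_def by blast
  interpret prob_space \<mu>
    using \<mu> by (simp add: torus_prob_def)
  have int: "integrable \<mu> (\<phi> v)" if "v \<in> S" for v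
  proof (rule integrable_const_bound[of _ 1])
    have "\<phi> v x \<le> 1" for x
      using member_le_sum[OF that _ \<open>finite S\<close>, of "\<lambda>v. \<phi> v x"] \<phi>(1,2) by simp
    then show "AE x in \<mu>. norm (\<phi> v x) \<le> 1"
      using \<phi>(1)[OF that] by simp
    have "\<phi> v \<in> borel_measurable borel"
      using \<phi>(3)[OF that] by (rule borel_measurable_continuous_onI)
    then show "\<phi> v \<in> borel_measurable \<mu>"
      using \<mu> measurable_cong_sets unfolding torus_prob_def by blast
  qed
  have "z = (\<Sum>v\<in>S. (\<integral>x. \<phi> v x \<partial>\<mu>) *\<^sub>R v)"
    unfolding z b using int by simp
  moreover have "(\<Sum>v\<in>S. \<integral>x. \<phi> v x \<partial>\<mu>) = 1"
    using int \<phi>(2) by (simp add: prob_space flip: Bochner_Integration.integral_sum)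
  moreover have "(\<integral>x. \<phi> v x \<partial>\<mu>) \<ge> 0" if "v \<in> S" for v
    using \<phi>(1)[OF that] by simp
  ultimately show "z \<in> convex hull S"
    unfolding convex_hull_finite[OF \<open>finite S\<close>] by (auto intro!: exI[of _ "\<lambda>v. \<integral>x. \<phi> v x \<partial>\<mu>"])
qed

text \<open>The coefficients \<open>c\<close> of a point of the hull serve as the masses of the
  closed orbits. On the lines of \<open>v\<close> the flow is translation with velocity
  \<open>v\<close>, so it preserves each orbit measure, and \<open>b\<close> has mean
  \<open>v\<close> there.\<close>

lemma convex_hull_subset_rotation_set:
  assumes "finite S" and per: "periodic3 b" and C1: "C1_on_R3 b" and X: "is_flow b X"
    and \<xi>: "\<And>v. v \<in> S \<Longrightarrow> int_vec (\<xi> v)" "\<And>v. v \<in> S \<Longrightarrow> v = r v *\<^sub>R \<xi> v"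
    and b: "\<And>v x. v \<in> S \<Longrightarrow> x \<in> closed_lines (\<xi> v) (a v) \<Longrightarrow> b x = v"
  shows "convex hull S \<subseteq> rotation_set b X"
proof
  fix z assume "z \<in> convex hull S"
  then obtain c where c: "\<forall>v\<in>S. c v \<ge> 0" "(\<Sum>v\<in>S. c v) = 1" "z = (\<Sum>v\<in>S. c v *\<^sub>R v)"
    unfolding convex_hull_finite[OF \<open>finite S\<close>] by auto
  obtain L where L: "\<And>x y. norm (b x - b y) \<le> L * norm (x - y)"
    using periodic3_C1_lipschitz[OF per C1] by blast
  have b_cont: "continuous_on UNIV b"
    using C1 unfolding C1_on_R3_def
    by (meson continuous_at_imp_continuous_on has_derivative_continuous)
  define p where "p v s = a v + s *\<^sub>R \<xi> v" for v s
  have p_lines: "p v s - int_part (p v s) \<in> closed_lines (\<xi> v) (a v)" if "v \<in> S" for v s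
  proof -
    \<comment> \<open>The point \<open>p v s\<close> lies on the line through \<open>a v\<close>, so
      only an integer cross product remains after reduction to the cell.\<close>
    have "cross3 (\<xi> v) (p v s - int_part (p v s) - a v) = - cross3 (\<xi> v) (int_part (p v s))"
      unfolding p_def by (simp add: Cross3.right_diff_distrib cross_add_right cross_mult_right)
    then show ?thesis
      using int_vec_cross[OF \<xi>(1)[OF that] int_vec_int_part] int_vec_minus
      by (simp add: closed_lines_def)
  qed
  define \<mu> where "\<mu> = orbit_mixture S c a \<xi>"
  note integral_mixture = integral_orbit_mixture[OF \<open>finite S\<close> c(1,2), where a = a and \<xi> = \<xi>,
      folded p_def \<mu>_def]
  have flow: "X t x = x + t *\<^sub>R v" if "v \<in> S" "x \<in> closed_lines (\<xi> v) (a v)" for v x t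
  proof (rule is_flow_unique[OF L X])
    fix t
    have "x + t *\<^sub>R v \<in> closed_lines (\<xi> v) (a v)"
      using closed_lines_add[OF that(2), of "t * r v"] \<xi>(2)[OF that(1)] by (metis scaleR_scaleR)
    then have "b (x + t *\<^sub>R v) = v"
      by (rule b[OF that(1)])
    then show "((\<lambda>t. x + t *\<^sub>R v) has_vector_derivative b (x + t *\<^sub>R v)) (at t)"
      by (auto intro!: derivative_eq_intros)
  qed simp
  have "invariant_measure X \<mu>"
    unfolding invariant_measure_def
  proof (intro conjI allI impI)
    show "torus_prob \<mu>"
      unfolding \<mu>_def by (rule torus_prob_orbit_mixture[OF \<open>finite S\<close> c(1,2)])
    fix \<psi> :: "vec3 \<Rightarrow> real" and t
    assume \<psi>: "continuous_on UNIV \<psi> \<and> periodic3 \<psi>"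
    then obtain B where B: "\<And>x. norm (\<psi> x) \<le> B"
      using periodic3_continuous_bounded by blast
    have eq: "(LBINT s:{0..1}. \<psi> (X t (p v s - int_part (p v s)))) =
        (LBINT s:{0..1}. \<psi> (p v s - int_part (p v s)))"
      if "v \<in> S" for v
    proof -
      \<comment> \<open>As \<open>v = r v *\<^sub>R \<xi> v\<close>, flowing for time
        \<open>t\<close> shifts the orbit parameter by \<open>t * r v\<close>; the leftover integer
        vector is invisible to \<open>\<psi>\<close>.\<close>
      have "p v s - int_part (p v s) + t *\<^sub>R v = p v (s + t * r v) + (- int_part (p v s))" for s
        unfolding p_def by (subst (4) \<xi>(2)[OF that]) (simp add: algebra_simps)
      then have "\<psi> (X t (p v s - int_part (p v s))) = \<psi> (p v (s + t * r v))" for s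
        using flow[OF that p_lines[OF that]] \<psi> int_vec_minus[OF int_vec_int_part]
        unfolding periodic3_def by metis
      moreover have "(LBINT s:{0..1}. \<psi> (p v (s + t * r v))) = (LBINT s:{0..1}. \<psi> (p v s))"
      proof (rule integral_periodic_shift)
        have "continuous_on UNIV (p v)"
          unfolding p_def by (intro continuous_intros)
        from continuous_on_compose2[OF conjunct1[OF \<psi>] this]
        show "continuous_on UNIV (\<lambda>s. \<psi> (p v s))" by simp
        have "p v (s + 1) = p v s + \<xi> v" for s
          by (simp add: p_def algebra_simps)
        then show "\<psi> (p v (s + 1)) = \<psi> (p v s)" for s
          using \<psi> \<xi>(1)[OF that] by (simp add: periodic3_def)
      qed
      ultimately show ?thesis
        using \<psi> by (simp add: periodic3_diff_int_part)
    qed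
    have meas: "\<psi> \<in> borel_measurable borel" "(\<lambda>y. \<psi> (X t y)) \<in> borel_measurable borel"
      using \<psi> is_flow_continuous[OF L X]
      by (blast intro: borel_measurable_continuous_onI continuous_on_compose2 subset_UNIV)+
    show "(\<integral>y. \<psi> (X t y) \<partial>\<mu>) = (\<integral>y. \<psi> y \<partial>\<mu>)"
      unfolding integral_mixture[OF meas(1) B] integral_mixture[OF meas(2) B]
      by (rule sum.cong) (simp_all only: eq)
  qed
  moreover have "(\<integral>y. b y \<partial>\<mu>) = z"
  proof -
    obtain B where "\<And>x. norm (b x) \<le> B"
      using periodic3_continuous_bounded[OF per b_cont] by blast
    then have "(\<integral>y. b y \<partial>\<mu>) = (\<Sum>v\<in>S. c v *\<^sub>R (LBINT s:{0..1::real}. b (p v s - int_part (p v s))))"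
      by (rule integral_mixture[OF borel_measurable_continuous_onI[OF b_cont]])
    also have "\<dots> = (\<Sum>v\<in>S. c v *\<^sub>R v)"
      using b[OF _ p_lines] by (intro sum.cong) (simp_all add: set_lebesgue_integral_def)
    finally show ?thesis
      using c(3) by simp
  qed
  ultimately show "z \<in> rotation_set b X"
    unfolding rotation_set_def by blast
qed

section \<open>Construction of the vector field\<close>

theorem theorem4p1:
  fixes S :: "vec3 set"
  assumes "finite S" and "S \<noteq> {}" and "\<forall>v\<in>S. rat_vec v"
  shows "\<exists>b :: vec3 \<Rightarrow> vec3. periodic3 b \<and> C1_on_R3 b \<and>
           (\<exists>X. is_flow b X) \<and>
           (\<forall>X. is_flow b X \<longrightarrow> rotation_set b X = convex hull S)"
proof -
  have "\<forall>v\<in>S. \<exists>\<xi> r. int_vec \<xi> \<and> \<xi> \<noteq> 0 \<and> v = r *\<^sub>R \<xi>"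
    using assms(3) rat_vec_direction by blast
  then obtain \<xi> r where \<xi>: "\<And>v. v \<in> S \<Longrightarrow> int_vec (\<xi> v)" "\<And>v. v \<in> S \<Longrightarrow> \<xi> v \<noteq> 0"
    "\<And>v. v \<in> S \<Longrightarrow> v = r v *\<^sub>R \<xi> v"
    by metis
  obtain u :: vec3 where u: "\<And>w. int_vec w \<Longrightarrow> w \<noteq> 0 \<Longrightarrow> w \<bullet> u \<notin> \<rat>"
    using exists_generic_vector by blast
  \<comment> \<open>Distinct natural labels give distinct multiples of the single generic vector
    \<open>u\<close>, which makes all the line families pairwise disjoint.\<close>
  obtain k :: "vec3 \<Rightarrow> nat" where k: "inj_on k S"
    using finite_imp_inj_to_nat_seg[OF assms(1)] by blast
  define a where "a v = real (k v) *\<^sub>R u" for v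
  have disjoint: "closed_lines (\<xi> v) (a v) \<inter> closed_lines (\<xi> w) (a w) = {}"
    if "v \<in> S" "w \<in> S" "v \<noteq> w" for v w
    unfolding a_def using that \<xi> k by (intro closed_lines_disjoint u) (auto dest: inj_onD)
  define g where "g v = line_fun (\<xi> v) (a v)" for v
  \<comment> \<open>\<open>P v\<close> vanishes on the lines of every vertex other than
    \<open>v\<close>; dividing by the sum yields a partition of unity. If \<open>v\<close> is the
    only vertex, the empty product gives the constant weight 1.\<close>
  define P where "P v x = (\<Prod>w\<in>S - {v}. g w x)" for v x
  define \<phi> where "\<phi> v x = P v x * inverse (\<Sum>w\<in>S. P w x)" for v x
  define b where "b x = (\<Sum>v\<in>S. \<phi> v x *\<^sub>R v)" for x
  have P_nonneg: "P v x \<ge> 0" for v x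
    by (simp add: P_def g_def line_fun_nonneg prod_nonneg)
  have P_pos: "(\<Sum>w\<in>S. P w x) > 0" for x
  proof -
    \<comment> \<open>By disjointness \<open>x\<close> lies on the lines of at most one vertex: take
      that vertex, or any vertex if there is none.\<close>
    have "\<exists>v\<in>S. \<forall>w\<in>S - {v}. g w x \<noteq> 0"
      using disjoint assms(2) unfolding g_def line_fun_eq_0_iff by blast
    then obtain v where "v \<in> S" "P v x \<noteq> 0"
      using assms(1) by (auto simp: P_def)
    then show ?thesis
      using P_nonneg assms(1) by (metis sum_pos2 order_le_neq_trans)
  qed
  have \<phi>_C1: "C1_scalar (\<phi> v)" for v
    unfolding \<phi>_def P_def using P_pos unfolding P_def
    by (intro C1_scalar_mult C1_scalar_inverse C1_scalar_sum C1_scalar_prod)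
      (simp_all add: g_def line_fun_C1 less_imp_neq[symmetric])
  have \<phi>_sum: "(\<Sum>v\<in>S. \<phi> v x) = 1" for x
    unfolding \<phi>_def using P_pos[of x] by (simp flip: sum_distrib_right)
  have "g v (x + m) = g v x" if "v \<in> S" "int_vec m" for v x m
    using line_fun_periodic[OF \<xi>(1)] that by (simp add: g_def periodic3_def)
  then have per: "periodic3 b"
    by (simp add: periodic3_def b_def \<phi>_def P_def)
  have C1: "C1_on_R3 b"
    unfolding b_def by (intro C1_on_R3_sum_scaleR \<phi>_C1)
  have b_lines: "b x = v" if "v \<in> S" "x \<in> closed_lines (\<xi> v) (a v)" for v x
  proof -
    have "g v x = 0"
      using that by (simp add: g_def line_fun_eq_0_iff)
    \<comment> \<open>For \<open>w \<noteq> v\<close> the product \<open>P w x\<close> contains the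
      factor \<open>g v x = 0\<close>, so all the weight falls on \<open>v\<close>.\<close>
    then have 0: "\<phi> w x = 0" if "w \<in> S - {v}" for w
      using that \<open>v \<in> S\<close> assms(1) by (auto simp: \<phi>_def P_def)
    then have "\<phi> v x = 1"
      using \<phi>_sum[of x] sum.remove[OF assms(1) \<open>v \<in> S\<close>, of "\<lambda>w. \<phi> w x"] by simp
    with 0 show ?thesis
      unfolding b_def by (simp add: sum.remove[OF assms(1) \<open>v \<in> S\<close>])
  qed
  have "rotation_set b X = convex hull S" if "is_flow b X" for X
  proof
    show "rotation_set b X \<subseteq> convex hull S"
      using P_nonneg P_pos
      by (intro rotation_set_subset_convex_hull[of S b \<phi>] assms(1) b_def \<phi>_sum C1_scalar_continuous \<phi>_C1)
        (simp add: \<phi>_def less_imp_le)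
    show "convex hull S \<subseteq> rotation_set b X"
      using convex_hull_subset_rotation_set[OF assms(1) per C1 that \<xi>(1,3) b_lines] by blast
  qed
  then show ?thesis
    using per C1 is_flow_exists[OF per C1] by blast
qed

end
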